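(* Let $X,Z$ be semigroups, $Y,W$ sets, let $R\subseteq X\times Y$ and $S\subseteq Z\times W$ be residuated relations, and let $\mathbf{b}\subseteq X\times W$ be a bond from $R$ to $S$. Then $\mathbf{b}$ is multiplicative if and only if the induced map $\mathbf{b}_*\colon\mathsf{M}R\to\mathsf{M}S$ preserves quantale multiplication, that is, $$\mathbf{b}_*(A\otimes_R B)=\mathbf{b}_*(A)\otimes_S\mathbf{b}_*(B)$$ for all $A,B\in\mathsf{M}R$.
   Context: For a relation $R\subseteq X\times Y$ (write $xRy$ for $(x,y)\in R$), $A\subseteq X$ and $B\subseteq Y$, put $R^{\uparrow}(A)=\{y\in Y\mid \forall a\in A,\ aRy\}$ and $R^{\downarrow}(B)=\{x\in X\mid \forall b\in B,\ xRb\}$. An $R$-extent is a subset $A\subseteq X$ with $A=R^{\downarrow}R^{\uparrow}(A)$; an $R$-intent is a subset $B\subseteq Y$ with $B=R^{\uparrow}R^{\downarrow}(B)$. $\mathsf{M}R$ is the complete lattice of $R$-extents ordered by inclusion, and $\mathrm{Int}(R)$ is the set of $R$-intents. For a semigroup $X$ and a set $Y$, a relation $R\subseteq X\times Y$ is residuated if there exist maps $\swarrow\colon Y\times X\to Y$ and $\searrow\colon X\times Y\to Y$ such that $(xx')Ry\iff xR(y\swarrow x')\iff x'R(x\searrow y)$ for all $x,x'\in X$, $y\in Y$. For a residuated relation $R$, $\mathsf{M}R$ is a quantale (complete lattice with associative multiplication preserving suprema in each variable) with multiplication $A\otimes_R B=R^{\downarrow}R^{\uparrow}(A*B)$, where $A*B=\{ab\mid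 a\in A,\ b\in B\}$, and suprema $\bigsqcup_i A_i=R^{\downarrow}R^{\uparrow}(\bigcup_i A_i)$. For intents $P,Q\in\mathrm{Int}(S)$ of a residuated relation $S$, put $P\otimes_S Q=S^{\uparrow}(S^{\downarrow}(P)*S^{\downarrow}(Q))$. A bond from $R\subseteq X\times Y$ to $S\subseteq Z\times W$ is a relation $\mathbf{b}\subseteq X\times W$ such that for every $x\in X$ the row $\mathbf{b}[x]=\{w\in W\mid x\mathbf{b}w\}$ is an $S$-intent, and for every $w\in W$ the column $\mathbf{b}^{-1}[w]=\{x\in X\mid x\mathbf{b}w\}$ is an $R$-extent. It induces the map $\mathbf{b}_*\colon\mathsf{M}R\to\mathsf{M}S$, $\mathbf{b}_*(A)=S^{\downarrow}\mathbf{b}^{\uparrow}(A)$, where $\mathbf{b}^{\uparrow}(A)=\{w\in W\mid\forall a\in A,\ a\mathbf{b}w\}$. A bond $\mathbf{b}$ between residuated relations $R,S$ is multiplicative if $\mathbf{b}[xx']=\mathbf{b}[x]\otimes_S\mathbf{b}[x']$ for all $x,x'\in X$. *)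

theory Defs
  imports "HOL-Library.FuncSet"
begin

text \<open>
  All sets are explicit carriers, so that they may be empty or proper subsets of their type.
  A relation is a set of pairs; since it does not determine the two sets it relates, these
  are passed along wherever they matter.
\<close>

definition semigroup_on :: "'x set \<Rightarrow> ('x \<Rightarrow> 'x \<Rightarrow> 'x) \<Rightarrow> bool" where
  "semigroup_on X f \<longleftrightarrow>
     (\<forall>x\<in>X. \<forall>y\<in>X. f x y \<in> X) \<and>
     (\<forall>x\<in>X. \<forall>y\<in>X. \<forall>z\<in>X. f (f x y) z = f x (f y z))"

text \<open>
  For \<open>R \<subseteq> X \<times> Y\<close>: the operators usually written \<open>R\<close>-up and \<open>R\<close>-down. The upper one needs
  only the codomain \<open>Y\<close>, the lower one only the domain \<open>X\<close>
  (these fix the values \<open>Y\<close> and \<open>X\<close> at the empty set).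
\<close>

definition rel_up :: "'y set \<Rightarrow> ('x \<times> 'y) set \<Rightarrow> 'x set \<Rightarrow> 'y set" where
  "rel_up Y R A = {y \<in> Y. \<forall>a\<in>A. (a, y) \<in> R}"

definition rel_down :: "'x set \<Rightarrow> ('x \<times> 'y) set \<Rightarrow> 'y set \<Rightarrow> 'x set" where
  "rel_down X R B = {x \<in> X. \<forall>b\<in>B. (x, b) \<in> R}"

text \<open>\<open>extents X Y R\<close> is the underlying set of the complete lattice \<open>M R\<close>.\<close>

definition extents :: "'x set \<Rightarrow> 'y set \<Rightarrow> ('x \<times> 'y) set \<Rightarrow> 'x set set" where
  "extents X Y R = {A. A \<subseteq> X \<and> A = rel_down X R (rel_up Y R A)}"

definition intents :: "'x set \<Rightarrow> 'y set \<Rightarrow> ('x \<times> 'y) set \<Rightarrow> 'y set set" where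
  "intents X Y R = {B. B \<subseteq> Y \<and> B = rel_up Y R (rel_down X R B)}"

definition residuated ::
    "'x set \<Rightarrow> ('x \<Rightarrow> 'x \<Rightarrow> 'x) \<Rightarrow> 'y set \<Rightarrow> ('x \<times> 'y) set \<Rightarrow> bool" where
  "residuated X f Y R \<longleftrightarrow> R \<subseteq> X \<times> Y \<and>
     (\<exists>rdiv \<in> Y \<rightarrow> X \<rightarrow> Y. \<exists>ldiv \<in> X \<rightarrow> Y \<rightarrow> Y.
        \<forall>x\<in>X. \<forall>x'\<in>X. \<forall>y\<in>Y.
          ((f x x', y) \<in> R \<longleftrightarrow> (x, rdiv y x') \<in> R) \<and>
          ((x, rdiv y x') \<in> R \<longleftrightarrow> (x', ldiv x y) \<in> R))"

definition set_prod :: "('x \<Rightarrow> 'x \<Rightarrow> 'x) \<Rightarrow> 'x set \<Rightarrow> 'x set \<Rightarrow> 'x set" where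
  "set_prod f A B = {f a b | a b. a \<in> A \<and> b \<in> B}"

definition extent_mult ::
    "'x set \<Rightarrow> ('x \<Rightarrow> 'x \<Rightarrow> 'x) \<Rightarrow> 'y set \<Rightarrow> ('x \<times> 'y) set \<Rightarrow> 'x set \<Rightarrow> 'x set \<Rightarrow> 'x set" where
  "extent_mult X f Y R A B = rel_down X R (rel_up Y R (set_prod f A B))"

definition intent_mult ::
    "'x set \<Rightarrow> ('x \<Rightarrow> 'x \<Rightarrow> 'x) \<Rightarrow> 'y set \<Rightarrow> ('x \<times> 'y) set \<Rightarrow> 'y set \<Rightarrow> 'y set \<Rightarrow> 'y set" where
  "intent_mult X f Y R P Q = rel_up Y R (set_prod f (rel_down X R P) (rel_down X R Q))"

text \<open>The row of \<open>b\<close> at \<open>x\<close> is \<open>b `` {x}\<close>; the column at \<open>w\<close> is \<open>b\<inverse> `` {w}\<close>.\<close>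

definition bond ::
    "'x set \<Rightarrow> 'y set \<Rightarrow> ('x \<times> 'y) set \<Rightarrow> 'z set \<Rightarrow> 'w set \<Rightarrow> ('z \<times> 'w) set
      \<Rightarrow> ('x \<times> 'w) set \<Rightarrow> bool" where
  "bond X Y R Z W S b \<longleftrightarrow> b \<subseteq> X \<times> W \<and>
     (\<forall>x\<in>X. b `` {x} \<in> intents Z W S) \<and>
     (\<forall>w\<in>W. b\<inverse> `` {w} \<in> extents X Y R)"

definition bond_map ::
    "'z set \<Rightarrow> 'w set \<Rightarrow> ('z \<times> 'w) set \<Rightarrow> ('x \<times> 'w) set \<Rightarrow> 'x set \<Rightarrow> 'z set" where
  "bond_map Z W S b A = rel_down Z S (rel_up W b A)"

definition multiplicative_bond ::
    "'x set \<Rightarrow> ('x \<Rightarrow> 'x \<Rightarrow> 'x) \<Rightarrow> 'z set \<Rightarrow> ('z \<Rightarrow> 'z \<Rightarrow> 'z) \<Rightarrow> 'w set \<Rightarrow> ('z \<times> 'w) set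
      \<Rightarrow> ('x \<times> 'w) set \<Rightarrow> bool" where
  "multiplicative_bond X f Z g W S b \<longleftrightarrow>
     (\<forall>x\<in>X. \<forall>x'\<in>X. b `` {f x x'} = intent_mult Z g W S (b `` {x}) (b `` {x'}))"

lemma extent_mult_in_extents: "extent_mult X f Y R A B \<in> extents X Y R"
  unfolding extent_mult_def extents_def rel_down_def rel_up_def by blast

lemma bond_map_in_extents: "bond_map Z W S b A \<in> extents Z W S"
proof -
  have "rel_up W b A \<subseteq> W" by (auto simp: rel_up_def)
  then show ?thesis
    unfolding bond_map_def extents_def by (fastforce simp: rel_down_def rel_up_def)
qed

end

theory Submission
  imports Defs
begin

text \<open>
  Since the columns of \<open>b\<close> are extents, \<open>b\<^sup>\<up>\<close> does not distinguish a set from its closure;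
  since its rows are intents, \<open>S\<^sup>\<up> (b\<^sub>* A) = b\<^sup>\<up> A = (\<Inter>a\<in>A. b[a])\<close>.
  Residuation says that each translate of a column \<open>{x. x R y}\<close> is again a column, so \<open>R\<^sup>\<up> (A * B)\<close>
  depends only on the closures of \<open>A\<close> and \<open>B\<close>. Hence both sides of the
  identity for \<open>b\<^sub>*\<close> are intersections over \<open>(a, a') \<in> A \<times> B\<close> of the two sides of the
  identity \<open>b[a a'] = b[a] \<otimes> b[a']\<close>, which in turn is the special case of the closures of
  two points.
\<close>

abbreviation rel_closure :: "'x set \<Rightarrow> 'y set \<Rightarrow> ('x \<times> 'y) set \<Rightarrow> 'x set \<Rightarrow> 'x set" where
  "rel_closure X Y R A \<equiv> rel_down X R (rel_up Y R A)"

lemma rel_closure_superset: "A \<subseteq> X \<Longrightarrow> A \<subseteq> rel_closure X Y R A"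
  unfolding rel_down_def rel_up_def by blast

lemma rel_closure_in_extents: "rel_closure X Y R A \<in> extents X Y R"
  unfolding extents_def rel_down_def rel_up_def by blast

lemma rel_up_down_up: "A \<subseteq> X \<Longrightarrow> rel_up Y R (rel_closure X Y R A) = rel_up Y R A"
  unfolding rel_down_def rel_up_def by blast

lemma rel_closure_least:
  assumes "A \<subseteq> E" and "E \<in> extents X Y R"
  shows "rel_closure X Y R A \<subseteq> E"
proof -
  have "rel_closure X Y R A \<subseteq> rel_closure X Y R E"
    using assms(1) unfolding rel_down_def rel_up_def by blast
  then show ?thesis using assms(2) unfolding extents_def by auto
qed

lemma rel_up_set_prod_mono:
  "A \<subseteq> A' \<Longrightarrow> B \<subseteq> B' \<Longrightarrow> rel_up Y R (set_prod f A' B') \<subseteq> rel_up Y R (set_prod f A B)"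
  unfolding rel_up_def set_prod_def by blast

lemma set_prod_subset:
  "semigroup_on X f \<Longrightarrow> A \<subseteq> X \<Longrightarrow> B \<subseteq> X \<Longrightarrow> set_prod f A B \<subseteq> X"
  unfolding set_prod_def semigroup_on_def by blast

text \<open>The column is \<open>rel_down X R {y}\<close>, and \<open>rel_down\<close> takes subsets
  of \<open>Y\<close> to closed sets.\<close>

lemma column_in_extents:
  assumes "y \<in> Y" shows "{x \<in> X. (x, y) \<in> R} \<in> extents X Y R"
  using assms unfolding extents_def rel_down_def rel_up_def by blast

text \<open>The two translates are the columns of \<open>R\<close> at \<open>rdiv y u\<close> and
  \<open>ldiv u y\<close>. Residuation enters the other arguments only through this fact.\<close>

lemma residuated_translate_in_extents:
  assumes "residuated X f Y R" and "y \<in> Y" and "u \<in> X"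
  shows "{x \<in> X. (f x u, y) \<in> R} \<in> extents X Y R"
    and "{x \<in> X. (f u x, y) \<in> R} \<in> extents X Y R"
proof -
  obtain rdiv ldiv where mem: "rdiv \<in> Y \<rightarrow> X \<rightarrow> Y" "ldiv \<in> X \<rightarrow> Y \<rightarrow> Y"
    and r: "\<And>x x' y. x \<in> X \<Longrightarrow> x' \<in> X \<Longrightarrow> y \<in> Y \<Longrightarrow> (f x x', y) \<in> R \<longleftrightarrow> (x, rdiv y x') \<in> R"
    and l: "\<And>x x' y. x \<in> X \<Longrightarrow> x' \<in> X \<Longrightarrow> y \<in> Y \<Longrightarrow> (f x x', y) \<in> R \<longleftrightarrow> (x', ldiv x y) \<in> R"
    using assms(1) unfolding residuated_def by blast
  have "rdiv y u \<in> Y" "ldiv u y \<in> Y" using mem assms(2,3) by auto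
  moreover have "{x \<in> X. (f x u, y) \<in> R} = {x \<in> X. (x, rdiv y u) \<in> R}"
    "{x \<in> X. (f u x, y) \<in> R} = {x \<in> X. (x, ldiv u y) \<in> R}"
    using r[OF _ assms(3,2)] l[OF assms(3) _ assms(2)] by auto
  ultimately show "{x \<in> X. (f x u, y) \<in> R} \<in> extents X Y R"
    and "{x \<in> X. (f u x, y) \<in> R} \<in> extents X Y R"
    by (simp_all add: column_in_extents)
qed

text \<open>The factors are closed one after the other. With \<open>y\<close> and the second factor
  fixed in \<open>B\<close>, the admissible first factors form an extent containing
  \<open>A\<close>, hence containing its closure. The same argument then closes \<open>B\<close>,
  with the first factor already ranging over the closure of \<open>A\<close>.\<close>

lemma rel_up_set_prod_closure:
  assumes res: "residuated X f Y R" and "A \<subseteq> X" and "B \<subseteq> X"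
  shows "rel_up Y R (set_prod f (rel_closure X Y R A) (rel_closure X Y R B)) =
         rel_up Y R (set_prod f A B)"
proof
  show "rel_up Y R (set_prod f (rel_closure X Y R A) (rel_closure X Y R B)) \<subseteq>
        rel_up Y R (set_prod f A B)"
    using assms(2,3) by (intro rel_up_set_prod_mono rel_closure_superset)
next
  show "rel_up Y R (set_prod f A B) \<subseteq>
        rel_up Y R (set_prod f (rel_closure X Y R A) (rel_closure X Y R B))"
  proof
    fix y assume y: "y \<in> rel_up Y R (set_prod f A B)"
    then have yY: "y \<in> Y" by (simp add: rel_up_def)
    have "rel_closure X Y R A \<subseteq> {x \<in> X. (f x u, y) \<in> R}" if "u \<in> B" for u
    proof (rule rel_closure_least)
      show "A \<subseteq> {x \<in> X. (f x u, y) \<in> R}"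
        using y that assms(2) unfolding rel_up_def set_prod_def by blast
      show "{x \<in> X. (f x u, y) \<in> R} \<in> extents X Y R"
        using that assms(3) by (intro residuated_translate_in_extents[OF res yY]) blast
    qed
    then have left: "(f v u, y) \<in> R" if "v \<in> rel_closure X Y R A" "u \<in> B" for u v
      using that by blast
    have "rel_closure X Y R B \<subseteq> {x \<in> X. (f v x, y) \<in> R}" if v: "v \<in> rel_closure X Y R A" for v
    proof (rule rel_closure_least)
      show "B \<subseteq> {x \<in> X. (f v x, y) \<in> R}"
        using left[OF v] assms(3) by blast
      show "{x \<in> X. (f v x, y) \<in> R} \<in> extents X Y R"
        using v by (intro residuated_translate_in_extents[OF res yY]) (simp add: rel_down_def)
    qed
    then show "y \<in> rel_up Y R (set_prod f (rel_closure X Y R A) (rel_closure X Y R B))"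
      using yY unfolding rel_up_def set_prod_def by blast
  qed
qed

text \<open>A point \<open>w\<close> of \<open>rel_up W b A\<close> is one whose column contains
  \<open>A\<close>; being an extent, this column contains the closure too.\<close>

lemma bond_up_closure:
  assumes "bond X Y R Z W S b" and "A \<subseteq> X"
  shows "rel_up W b (rel_closure X Y R A) = rel_up W b A"
proof
  show "rel_up W b (rel_closure X Y R A) \<subseteq> rel_up W b A"
    using rel_closure_superset[OF assms(2), of R Y] unfolding rel_up_def by blast
next
  show "rel_up W b A \<subseteq> rel_up W b (rel_closure X Y R A)"
  proof
    fix w assume w: "w \<in> rel_up W b A"
    then have "w \<in> W" and "A \<subseteq> b\<inverse> `` {w}" by (auto simp: rel_up_def)
    then have "rel_closure X Y R A \<subseteq> b\<inverse> `` {w}"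
      using assms(1) by (intro rel_closure_least) (auto simp: bond_def)
    with \<open>w \<in> W\<close> show "w \<in> rel_up W b (rel_closure X Y R A)" by (auto simp: rel_up_def)
  qed
qed

lemma bond_row:
  assumes "bond X Y R Z W S b" and "x \<in> X"
  shows "rel_up W S (rel_down Z S (b `` {x})) = b `` {x}"
  using assms unfolding bond_def intents_def by blast

text \<open>\<open>rel_up W S\<close> turns the union into an intersection, and each row is an
  intent, so it is recovered from its \<open>rel_down\<close>. For empty \<open>A\<close> both sides
  are \<open>W\<close>.\<close>

lemma rel_up_UN_rows:
  assumes "bond X Y R Z W S b" and "A \<subseteq> X"
  shows "rel_up W S (\<Union>a\<in>A. rel_down Z S (b `` {a})) = rel_up W b A"
proof -
  have "rel_up W S (\<Union>a\<in>A. rel_down Z S (b `` {a})) =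
      {w \<in> W. \<forall>a\<in>A. w \<in> rel_up W S (rel_down Z S (b `` {a}))}"
    unfolding rel_up_def by blast
  also have "\<dots> = {w \<in> W. \<forall>a\<in>A. w \<in> b `` {a}}"
    using bond_row[OF assms(1)] assms(2) by (simp add: subset_iff cong: ball_cong conj_cong)
  also have "\<dots> = rel_up W b A" by (auto simp: rel_up_def)
  finally show ?thesis .
qed

text \<open>This exhibits the image of \<open>A\<close> as a join in M S of the images of points, a
  form to which \<open>rel_up_set_prod_closure\<close> applies.\<close>

lemma bond_map_eq_closure:
  assumes "bond X Y R Z W S b" and "A \<subseteq> X"
  shows "bond_map Z W S b A = rel_closure Z W S (\<Union>a\<in>A. rel_down Z S (b `` {a}))"
  unfolding bond_map_def rel_up_UN_rows[OF assms] ..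

text \<open>Once the closures are dropped from both factors, the product of the two unions is the
  union of the pairwise products, and \<open>rel_up W S\<close> of each of these is an
  \<open>intent_mult\<close>.\<close>

lemma rel_up_bond_map_prod:
  assumes "residuated Z g W S" and "bond X Y R Z W S b" and "A \<subseteq> X" and "B \<subseteq> X"
  shows "rel_up W S (set_prod g (bond_map Z W S b A) (bond_map Z W S b B)) =
         {w \<in> W. \<forall>a\<in>A. \<forall>a'\<in>B. w \<in> intent_mult Z g W S (b `` {a}) (b `` {a'})}"
proof -
  have sub: "(\<Union>a\<in>C. rel_down Z S (b `` {a})) \<subseteq> Z" for C
    by (auto simp: rel_down_def)
  show ?thesis
    unfolding bond_map_eq_closure[OF assms(2,3)] bond_map_eq_closure[OF assms(2,4)]
      rel_up_set_prod_closure[OF assms(1) sub sub]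
    unfolding intent_mult_def set_prod_def rel_up_def by blast
qed

lemma rel_up_set_prod_rows:
  "rel_up W b (set_prod f A B) = {w \<in> W. \<forall>a\<in>A. \<forall>a'\<in>B. w \<in> b `` {f a a'}}"
  unfolding rel_up_def set_prod_def by blast

theorem proposition5p3:
  fixes X :: "'x set" and f :: "'x \<Rightarrow> 'x \<Rightarrow> 'x"
    and Z :: "'z set" and g :: "'z \<Rightarrow> 'z \<Rightarrow> 'z"
    and Y :: "'y set" and W :: "'w set"
    and R :: "('x \<times> 'y) set" and S :: "('z \<times> 'w) set" and b :: "('x \<times> 'w) set"
  assumes "semigroup_on X f" and "semigroup_on Z g"
    and "residuated X f Y R" and "residuated Z g W S"
    and "bond X Y R Z W S b"
  shows "multiplicative_bond X f Z g W S b \<longleftrightarrow>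
    (\<forall>A \<in> extents X Y R. \<forall>B \<in> extents X Y R.
       bond_map Z W S b (extent_mult X f Y R A B) =
       extent_mult Z g W S (bond_map Z W S b A) (bond_map Z W S b B))"
proof -
  note bond = assms(5)
  show ?thesis
  proof (intro iffI ballI)
    fix A B
    assume mult: "multiplicative_bond X f Z g W S b"
      and "A \<in> extents X Y R" and "B \<in> extents X Y R"
    then have AX: "A \<subseteq> X" and BX: "B \<subseteq> X" by (auto simp: extents_def)
    have row: "b `` {f a a'} = intent_mult Z g W S (b `` {a}) (b `` {a'})"
      if "a \<in> A" "a' \<in> B" for a a'
      using mult that AX BX unfolding multiplicative_bond_def by blast
    \<comment> \<open>Both sides of the goal are values of \<open>rel_down Z S\<close>, so it
      suffices to equate its arguments.\<close>
    have "rel_up W b (extent_mult X f Y R A B) = rel_up W b (set_prod f A B)"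
      unfolding extent_mult_def
      by (rule bond_up_closure[OF bond set_prod_subset[OF assms(1) AX BX]])
    also have "\<dots> = {w \<in> W. \<forall>a\<in>A. \<forall>a'\<in>B. w \<in> intent_mult Z g W S (b `` {a}) (b `` {a'})}"
      unfolding rel_up_set_prod_rows using row by simp
    also have "\<dots> = rel_up W S (set_prod g (bond_map Z W S b A) (bond_map Z W S b B))"
      using rel_up_bond_map_prod[OF assms(4) bond AX BX] ..
    finally show "bond_map Z W S b (extent_mult X f Y R A B) =
        extent_mult Z g W S (bond_map Z W S b A) (bond_map Z W S b B)"
      by (simp add: bond_map_def extent_mult_def)
  next
    assume pres: "\<forall>A \<in> extents X Y R. \<forall>B \<in> extents X Y R.
       bond_map Z W S b (extent_mult X f Y R A B) =
       extent_mult Z g W S (bond_map Z W S b A) (bond_map Z W S b B)"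
    \<comment> \<open>The assumption speaks only of extents, so a point is represented by its
      closure.\<close>
    have point: "bond_map Z W S b (rel_closure X Y R {x}) = rel_down Z S (b `` {x})"
      if "x \<in> X" for x
    proof -
      have "rel_up W b {x} = b `` {x}"
        using bond by (auto simp: rel_up_def bond_def)
      then show ?thesis
        unfolding bond_map_def using bond_up_closure[OF bond, of "{x}"] that by simp
    qed
    show "multiplicative_bond X f Z g W S b"
      unfolding multiplicative_bond_def
    proof (intro ballI)
      fix x x' assume x: "x \<in> X" "x' \<in> X"
      let ?P = "set_prod g (rel_down Z S (b `` {x})) (rel_down Z S (b `` {x'}))"
      have fx: "f x x' \<in> X" using assms(1) x by (simp add: semigroup_on_def)
      have PZ: "?P \<subseteq> Z"
        by (rule set_prod_subset[OF assms(2)]) (auto simp: rel_down_def)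
      \<comment> \<open>The closures of two points multiply to the closure of their product.\<close>
      have "set_prod f {x} {x'} = {f x x'}" by (auto simp: set_prod_def)
      then have "extent_mult X f Y R (rel_closure X Y R {x}) (rel_closure X Y R {x'}) =
          rel_closure X Y R {f x x'}"
        using rel_up_set_prod_closure[OF assms(3), of "{x}" "{x'}"] x
        by (simp add: extent_mult_def)
      then have "rel_down Z S (b `` {f x x'}) = rel_closure Z W S ?P"
        using pres[rule_format, OF rel_closure_in_extents rel_closure_in_extents, of "{x}" "{x'}"]
          point x fx by (simp add: extent_mult_def)
      \<comment> \<open>Apply \<open>rel_up W S\<close> to both sides: the row on the left is an
        intent, and on the right the closure of \<open>?P\<close> is absorbed.\<close>
      then show "b `` {f x x'} = intent_mult Z g W S (b `` {x}) (b `` {x'})"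
        unfolding intent_mult_def by (metis bond_row[OF bond fx] rel_up_down_up[OF PZ])
    qed
  qed
qed

end
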